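(* Let $\mathcal{H}$ be a hypergraph with no isolated vertices. Then: (a) If $|e| \leq 3$ for every $e \in \mathcal{H}$, then $L(\mathrm{NC}(\mathcal{H})) \leq |V(\mathcal{H})| - \left\lceil\frac{\tilde{\gamma}(\mathcal{H})}{2}\right\rceil -1$. (b) If $|e| \leq 2$ for every $e \in \mathcal{H}$, then $L(\mathrm{NC}(\mathcal{H})) \leq |V(\mathcal{H})| - \gamma_{si}(\mathcal{H}) -1$. (c) $L(\mathrm{NC}(\mathcal{H})) \leq |V(\mathcal{H})| - \gamma_{E}(\mathcal{H}) -1$.
   Context: A hypergraph $\mathcal{H}$ on a finite vertex set $V=V(\mathcal{H})$ is a collection of distinct non-empty subsets of $V$, called edges. A singleton edge $\{v\}$ is called a loop. A vertex is isolated if no edge contains it. Noncover complex: $W\subseteq V$ is a cover of $\mathcal{H}$ if it meets every edge, and a noncover otherwise. $\mathrm{NC}(\mathcal{H})$ is the abstract simplicial complex on $V$ whose faces are the noncovers of $\mathcal{H}$. If $\mathcal{H}$ has no edges, this is the void complex (no faces, vanishing reduced homology in all dimensions). Leray number: a simplicial complex $K$ on $V$ is $d$-Leray if $\tilde{H}_i(K[W])=0$ for all $i\geq d$ and all $W\subseteq V$, where $K[W]$ is the subcomplex of faces contained in $W$ and $\tilde{H}_i$ is reduced homology with $\mathbb{Z}_2$ coefficients. $L(K)$ is the minimum integer $d$ such that $K$ is $d$-Leray. (The void complex is $d$-Leray for every integer $d$; set $L=-\infty$ for it, so that $L(K)\le d$ always means "$K$ is $d$-Leray".) Domination: $W\subseteq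 V$ dominates a vertex $v$ if there is $W'\subseteq W\setminus\{v\}$ with $W'\cup\{v\}\in\mathcal{H}$ (in particular the empty set dominates $v$ if $\{v\}$ is a loop). $W$ dominates $A\subseteq V$ if it dominates every vertex of $A$. Let $\gamma(\mathcal{H};A)=\min\{|W| : W\subseteq V,\ W \text{ dominates } A\}$ and $\tilde{\gamma}(\mathcal{H})=\gamma(\mathcal{H};V)$. A set $A\subseteq V$ is strongly independent if it contains no edge of $\mathcal{H}$ and every edge contains at most one vertex of $A$. Let $\gamma_{si}(\mathcal{H})=\max\{\gamma(\mathcal{H};A) : A \text{ strongly independent in } \mathcal{H}\}$. Let $\gamma_E(\mathcal{H})=\min\{|\mathcal{F}| : \mathcal{F}\subseteq\mathcal{H},\ \bigcup_{F\in\mathcal{F}}F \text{ dominates } V\}$. *)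

theory Defs
  imports
    "HOL-Algebra.Elementary_Groups"
    "HOL-Library.Z2"
    "HOL-Library.Extended_Real"
begin

section \<open>Reduced simplicial homology with coefficients in the field with two elements\<close>

text \<open>
  A simplicial complex is given by its set of faces. The empty set is a face, of dimension -1, of
  every complex other than the void complex \<open>{}\<close>, so the chain groups below form the
  augmented chain complex.
\<close>

definition chain_group :: "'a set set \<Rightarrow> int \<Rightarrow> ('a set \<Rightarrow> bit) monoid" where
  "chain_group K i =
     \<lparr>carrier = {c. \<forall>F. c F \<noteq> 0 \<longrightarrow> F \<in> K \<and> int (card F) = i + 1},
      monoid.mult = (\<lambda>c d F. c F + d F),
      one = (\<lambda>F. 0)\<rparr>"

text \<open>
  The coefficient of \<open>G\<close> in the boundary of \<open>c\<close> is the sum of the coefficients of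
  the faces having \<open>G\<close> as a facet; these are the faces \<open>insert v G\<close> with
  \<open>v \<notin> G\<close>.
\<close>

definition boundary_map :: "'a set set \<Rightarrow> ('a set \<Rightarrow> bit) \<Rightarrow> 'a set \<Rightarrow> bit" where
  "boundary_map K c = (\<lambda>G. \<Sum>v | v \<notin> G \<and> insert v G \<in> K. c (insert v G))"

definition cycles :: "'a set set \<Rightarrow> int \<Rightarrow> ('a set \<Rightarrow> bit) set" where
  "cycles K i = kernel (chain_group K i) (chain_group K (i - 1)) (boundary_map K)"

definition boundaries :: "'a set set \<Rightarrow> int \<Rightarrow> ('a set \<Rightarrow> bit) set" where
  "boundaries K i = boundary_map K ` carrier (chain_group K (i + 1))"

definition reduced_homology :: "'a set set \<Rightarrow> int \<Rightarrow> ('a set \<Rightarrow> bit) set monoid" where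
  "reduced_homology K i = (chain_group K i)\<lparr>carrier := cycles K i\<rparr> Mod boundaries K i"


section \<open>Leray number\<close>

definition induced_subcomplex :: "'a set set \<Rightarrow> 'a set \<Rightarrow> 'a set set" where
  "induced_subcomplex K W = {F \<in> K. F \<subseteq> W}"

definition is_Leray :: "'a set \<Rightarrow> 'a set set \<Rightarrow> int \<Rightarrow> bool" where
  "is_Leray V K d \<longleftrightarrow>
     (\<forall>i\<ge>d. \<forall>W\<subseteq>V. trivial_group (reduced_homology (induced_subcomplex K W) i))"

text \<open>
  For a non-void complex on a finite vertex set the minimum exists (and is nonnegative, since
  \<open>W = {}\<close> gives the complex \<open>{{}}\<close>, whose homology in dimension -1 is nonzero).
  The void complex satisfies the Leray condition for every integer.
\<close>

definition Leray_number :: "'a set \<Rightarrow> 'a set set \<Rightarrow> ereal" where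
  "Leray_number V K =
     (if K = {} then - \<infinity> else ereal (real_of_int (LEAST d. is_Leray V K d)))"


section \<open>Hypergraphs and the noncover complex\<close>

definition hypergraph :: "'a set \<Rightarrow> 'a set set \<Rightarrow> bool" where
  "hypergraph V H \<longleftrightarrow> finite V \<and> (\<forall>e\<in>H. e \<subseteq> V \<and> e \<noteq> {})"

definition isolated :: "'a set set \<Rightarrow> 'a \<Rightarrow> bool" where
  "isolated H v \<longleftrightarrow> (\<forall>e\<in>H. v \<notin> e)"

definition cover :: "'a set set \<Rightarrow> 'a set \<Rightarrow> bool" where
  "cover H W \<longleftrightarrow> (\<forall>e\<in>H. W \<inter> e \<noteq> {})"

definition noncover_complex :: "'a set \<Rightarrow> 'a set set \<Rightarrow> 'a set set" where
  "noncover_complex V H = {W. W \<subseteq> V \<and> \<not> cover H W}"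


section \<open>Domination parameters\<close>

definition dominates_vertex :: "'a set set \<Rightarrow> 'a set \<Rightarrow> 'a \<Rightarrow> bool" where
  "dominates_vertex H W v \<longleftrightarrow> (\<exists>W'\<subseteq>W - {v}. W' \<union> {v} \<in> H)"

definition dominates :: "'a set set \<Rightarrow> 'a set \<Rightarrow> 'a set \<Rightarrow> bool" where
  "dominates H W A \<longleftrightarrow> (\<forall>v\<in>A. dominates_vertex H W v)"

text \<open>
  If no vertex is isolated then \<open>V\<close> dominates itself, and every minimum and maximum below
  ranges over a finite nonempty set.
\<close>

definition domination_number_of :: "'a set \<Rightarrow> 'a set set \<Rightarrow> 'a set \<Rightarrow> nat" where
  "domination_number_of V H A = Min {card W | W. W \<subseteq> V \<and> dominates H W A}"

definition strong_total_domination_number :: "'a set \<Rightarrow> 'a set set \<Rightarrow> nat" where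
  "strong_total_domination_number V H = domination_number_of V H V"

definition strongly_independent :: "'a set \<Rightarrow> 'a set set \<Rightarrow> 'a set \<Rightarrow> bool" where
  "strongly_independent V H A \<longleftrightarrow>
     A \<subseteq> V \<and> (\<forall>e\<in>H. \<not> e \<subseteq> A) \<and> (\<forall>e\<in>H. card (e \<inter> A) \<le> 1)"

definition strong_independence_domination_number :: "'a set \<Rightarrow> 'a set set \<Rightarrow> nat" where
  "strong_independence_domination_number V H =
     Max {domination_number_of V H A | A. strongly_independent V H A}"

definition edgewise_domination_number :: "'a set \<Rightarrow> 'a set set \<Rightarrow> nat" where
  "edgewise_domination_number V H = Min {card F | F. F \<subseteq> H \<and> dominates H (\<Union>F) V}"

end

(*
  Deleting an edge e splits the noncover complex: NC(H) is the union of NC(H - e) and the full simplex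
  on V - e, and these meet in NC of the traces of the other edges on V - e. By Mayer-Vietoris and
  induction on the number of edges, the homology vanishes above a bound as soon as each domination
  parameter drops by at most |e| - 1 in passing to the traces, for a suitable e. One may assume
  that the edges form an antichain, since NC only depends on the minimal edges; and if a deletion
  isolates a vertex, the complex is a cone. For the Leray number, an induced subcomplex on W is again
  the noncover complex of the traces on W, so it remains to see that restricting to W lowers the
  parameters by at most |V - W|.
*)
theory Submission
  imports Defs
begin

section \<open>Homology of finite complexes\<close>

text \<open>Why |e| - 1: the intersection has |V| - |e| vertices and is needed one dimension lower,
  so the threshold |V| - n - 1 is passed on exactly when n turns into n - (|e| - 1). For a loop this
  allows no loss at all, and here the antichain helps: no other edge contains the vertex of the
  loop. For |e| >= 2, the whole edge can be added to a dominating set in (a) and (c). It costs |e|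
  \<le> 2 (|e| - 1) vertices, which is why (a) holds with half of the parameter, or one edge. In (b)
  only one vertex may be spent, so e is taken through a vertex of the independent set and only its
  other end is added. Induced subcomplexes come without a shift of dimension, so each vertex outside
  W may cost one unit: two vertices in (a), one vertex in (b), one edge in (c). An edge of size at
  most 3 has at most two vertices besides a given one, which is where the 3 in (a) enters.\<close>

definition simplicial_complex :: "'a set \<Rightarrow> 'a set set \<Rightarrow> bool" where
  "simplicial_complex V K \<longleftrightarrow> finite V \<and> K \<subseteq> Pow V \<and> (\<forall>F\<in>K. \<forall>G\<subseteq>F. G \<in> K)"

definition vanishing_homology :: "'a set set \<Rightarrow> int \<Rightarrow> bool" where
  "vanishing_homology K i \<longleftrightarrow> cycles K i \<subseteq> boundaries K i"

definition chains :: "'a set set \<Rightarrow> int \<Rightarrow> ('a set \<Rightarrow> bit) set" where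
  "chains K i = {c. \<forall>F. c F \<noteq> 0 \<longrightarrow> F \<in> K \<and> int (card F) = i + 1}"

text \<open>Summing over \<open>V - G\<close> rather than over the faces of a complex makes the
  boundary independent of the complex, so chains of \<open>K\<close>, \<open>L\<close> and
  \<open>K \<inter> L\<close> can be compared. On chains of \<open>K\<close> it agrees with
  \<open>boundary_map K\<close>.\<close>

definition boundary_in :: "'a set \<Rightarrow> ('a set \<Rightarrow> bit) \<Rightarrow> 'a set \<Rightarrow> bit" where
  "boundary_in V c = (\<lambda>G. \<Sum>v\<in>V - G. c (insert v G))"

lemma bit_add_self [simp]: "(x::bit) + x = 0"
  by (cases x) auto

lemma bit_add_eq_0_iff: "(x::bit) + y = 0 \<longleftrightarrow> x = y"
  by (cases x; cases y) auto

declare add_bit_eq_xor [simp del]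

lemma carrier_chain_group [simp]: "carrier (chain_group K i) = chains K i"
  by (simp add: chain_group_def chains_def)

lemma mult_chain_group [simp]: "c \<otimes>\<^bsub>chain_group K i\<^esub> d = (\<lambda>F. c F + d F)"
  by (simp add: chain_group_def)

lemma one_chain_group [simp]: "\<one>\<^bsub>chain_group K i\<^esub> = (\<lambda>F. 0)"
  by (simp add: chain_group_def)

lemma zero_in_chains: "(\<lambda>F. 0) \<in> chains K i"
  by (simp add: chains_def)

lemma add_in_chains:
  assumes "c \<in> chains K i" "d \<in> chains K i"
  shows "(\<lambda>F. c F + d F) \<in> chains K i"
proof -
  have "c F \<noteq> 0 \<or> d F \<noteq> 0" if "c F + d F \<noteq> 0" for F
    using that by auto
  then show ?thesis
    using assms unfolding chains_def by blast
qed

lemma chains_mono: "K \<subseteq> L \<Longrightarrow> chains K i \<subseteq> chains L i"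
  by (auto simp: chains_def)

lemma comm_group_chain_group: "comm_group (chain_group K i)"
proof (rule comm_groupI)
  fix c assume "c \<in> carrier (chain_group K i)"
  then show "\<exists>d\<in>carrier (chain_group K i). d \<otimes>\<^bsub>chain_group K i\<^esub> c = \<one>\<^bsub>chain_group K i\<^esub>"
    by (intro bexI[of _ c]) auto
qed (auto simp: zero_in_chains add_in_chains add.assoc add.commute)

lemma boundary_map_eq:
  assumes "K \<subseteq> Pow V" "finite V" "c \<in> chains K i"
  shows "boundary_map K c = boundary_in V c"
proof
  fix G
  show "boundary_map K c G = boundary_in V c G"
    unfolding boundary_map_def boundary_in_def
    by (rule sum.mono_neutral_left) (use assms in \<open>auto simp: chains_def\<close>)
qed

lemma boundary_in_add:
  "boundary_in V (\<lambda>F. c F + d F) = (\<lambda>F. boundary_in V c F + boundary_in V d F)"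
  by (simp add: boundary_in_def sum.distrib)

lemma boundary_in_zero: "boundary_in V (\<lambda>F. 0) = (\<lambda>F. 0)"
  by (simp add: boundary_in_def)

text \<open>Each unordered pair is counted twice, which cancels modulo 2. This replaces the usual
  sign argument for the boundary of a boundary.\<close>

lemma sum_symmetric_off_diagonal:
  fixes h :: "'a \<Rightarrow> 'a \<Rightarrow> bit"
  assumes "finite S" and sym: "\<And>v w. h v w = h w v"
  shows "(\<Sum>v\<in>S. \<Sum>w\<in>S - {v}. h v w) = 0"
  using assms(1)
proof (induction S)
  case empty
  show ?case by simp
next
  case (insert x S)
  have "(\<Sum>w\<in>insert x S - {v}. h v w) = h v x + (\<Sum>w\<in>S - {v}. h v w)" if "v \<in> S" for v
  proof -
    have "insert x S - {v} = insert x (S - {v})"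
      using insert that by auto
    then show ?thesis
      using insert by simp
  qed
  then have "(\<Sum>v\<in>S. \<Sum>w\<in>insert x S - {v}. h v w) = (\<Sum>v\<in>S. h v x)"
    using insert.IH by (simp add: sum.distrib)
  moreover have "(\<Sum>w\<in>insert x S - {x}. h x w) = (\<Sum>v\<in>S. h v x)"
    using insert.hyps sym[of x] by simp
  ultimately show ?case
    using insert by simp
qed

lemma boundary_in_boundary_in:
  assumes "finite V"
  shows "boundary_in V (boundary_in V c) = (\<lambda>F. 0)"
proof
  fix G
  have "boundary_in V (boundary_in V c) G
      = (\<Sum>v\<in>V - G. \<Sum>w\<in>V - G - {v}. c (insert w (insert v G)))"
    unfolding boundary_in_def by (intro sum.cong) auto
  also have "\<dots> = 0"
    using assms by (intro sum_symmetric_off_diagonal) (auto simp: insert_commute)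
  finally show "boundary_in V (boundary_in V c) G = 0" .
qed

lemma boundary_in_chains:
  assumes "simplicial_complex V K" "c \<in> chains K i"
  shows "boundary_in V c \<in> chains K (i - 1)"
proof -
  have "G \<in> K \<and> int (card G) = i" if "boundary_in V c G \<noteq> 0" for G
  proof -
    obtain v where v: "v \<in> V - G" "c (insert v G) \<noteq> 0"
      using \<open>boundary_in V c G \<noteq> 0\<close> unfolding boundary_in_def by (meson sum.neutral)
    then have vG: "insert v G \<in> K" "int (card (insert v G)) = i + 1"
      using assms(2) by (auto simp: chains_def)
    then have "G \<in> K" "finite G"
      using assms(1) unfolding simplicial_complex_def
      by (meson subset_insertI, meson PowD finite_insert finite_subset subsetD)
    then show ?thesis
      using vG v by simp
  qed
  then show ?thesis
    by (simp add: chains_def)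
qed

lemma cycles_eq:
  assumes "simplicial_complex V K"
  shows "cycles K i = {c \<in> chains K i. boundary_in V c = (\<lambda>F. 0)}"
  using assms unfolding cycles_def kernel_def simplicial_complex_def
  by (auto simp: boundary_map_eq)

lemma boundaries_eq:
  assumes "simplicial_complex V K"
  shows "boundaries K i = boundary_in V ` chains K (i + 1)"
  using assms unfolding boundaries_def simplicial_complex_def
  by (auto simp: boundary_map_eq image_iff)

lemma boundaries_subset_cycles:
  assumes "simplicial_complex V K"
  shows "boundaries K i \<subseteq> cycles K i"
  using assms boundary_in_chains[OF assms, of _ "i + 1"]
  by (auto simp: cycles_eq[OF assms] boundaries_eq[OF assms] boundary_in_boundary_in
      simplicial_complex_def)

text \<open>Modulo 2 every chain is its own inverse, so closure under sums suffices.\<close>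

lemma subgroup_chain_group:
  assumes "S \<subseteq> chains K i" "(\<lambda>F. 0) \<in> S" "\<And>c d. c \<in> S \<Longrightarrow> d \<in> S \<Longrightarrow> (\<lambda>F. c F + d F) \<in> S"
  shows "subgroup S (chain_group K i)"
proof -
  interpret comm_group "chain_group K i"
    by (rule comm_group_chain_group)
  have "inv\<^bsub>chain_group K i\<^esub> c = c" if "c \<in> S" for c
    using that assms(1) by (intro inv_equality) auto
  then show ?thesis
    using assms by (intro subgroupI) auto
qed

lemma trivial_reduced_homology_iff:
  assumes K: "simplicial_complex V K"
  shows "trivial_group (reduced_homology K i) \<longleftrightarrow> vanishing_homology K i"
proof -
  let ?G = "chain_group K i" and ?Z = "cycles K i" and ?B = "boundaries K i"
  let ?ZG = "?G\<lparr>carrier := ?Z\<rparr>"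
  interpret C: comm_group ?G
    by (rule comm_group_chain_group)
  have Z: "subgroup ?Z ?G"
  proof (rule subgroup_chain_group)
    show "(\<lambda>F. c F + d F) \<in> ?Z" if "c \<in> ?Z" "d \<in> ?Z" for c d
      using that by (simp add: cycles_eq[OF K] add_in_chains boundary_in_add)
  qed (auto simp: cycles_eq[OF K] zero_in_chains boundary_in_zero)
  have zero_B: "(\<lambda>F. 0) \<in> ?B"
    unfolding boundaries_eq[OF K]
    by (rule image_eqI, rule boundary_in_zero[symmetric], rule zero_in_chains)
  have "subgroup ?B ?G"
  proof (rule subgroup_chain_group)
    show "?B \<subseteq> chains K i"
      using boundaries_subset_cycles[OF K] by (auto simp: cycles_eq[OF K])
    show "(\<lambda>F. c F + d F) \<in> ?B" if "c \<in> ?B" "d \<in> ?B" for c d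
      using that unfolding boundaries_eq[OF K]
      by (elim imageE) (simp only: boundary_in_add[symmetric] add_in_chains image_eqI)
  qed (rule zero_B)
  then have BZ: "subgroup ?B ?ZG"
    using Z boundaries_subset_cycles[OF K] by (simp add: C.subgroup_incl)
  interpret ZG: comm_group ?ZG
    by (rule group.group_comm_groupI[OF subgroup.subgroup_is_group[OF Z C.is_group]])
      (simp add: add.commute)
  have normal: "normal ?B ?ZG"
    using BZ by (rule ZG.subgroup_imp_normal)
  \<comment> \<open>\<open>?B\<close> is the unit of the quotient, so triviality means that it is
    the only coset.\<close>
  have triv: "trivial_group (reduced_homology K i) \<longleftrightarrow> rcosets\<^bsub>?ZG\<^esub> ?B = {?B}"
    using normal.factorgroup_is_group[OF normal]
    by (simp add: reduced_homology_def trivial_group_def FactGroup_def)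
  show ?thesis
  proof
    assume "trivial_group (reduced_homology K i)"
    then have "?B #>\<^bsub>?ZG\<^esub> c = ?B" if "c \<in> ?Z" for c
      using triv that by (auto simp: RCOSETS_def)
    moreover have "c \<in> ?B #>\<^bsub>?ZG\<^esub> c" for c
      using zero_B by (force simp: r_coset_def)
    ultimately show "vanishing_homology K i"
      by (auto simp: vanishing_homology_def)
  next
    assume "vanishing_homology K i"
    then have "?B = carrier ?ZG"
      using boundaries_subset_cycles[OF K] by (auto simp: vanishing_homology_def)
    then have "rcosets\<^bsub>?ZG\<^esub> ?B = {?B}"
      using ZG.coset_join2[OF _ BZ] ZG.one_closed by (auto simp: RCOSETS_def)
    then show "trivial_group (reduced_homology K i)"
      using triv by simp
  qed
qed

section \<open>Criteria for vanishing homology: cones, simplices and unions\<close>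

lemma vanishing_homologyI:
  assumes "simplicial_complex V K"
    and "\<And>c. c \<in> chains K i \<Longrightarrow> boundary_in V c = (\<lambda>F. 0) \<Longrightarrow> \<exists>d\<in>chains K (i + 1). boundary_in V d = c"
  shows "vanishing_homology K i"
  unfolding vanishing_homology_def cycles_eq[OF assms(1)] boundaries_eq[OF assms(1)]
  using assms(2) by blast

lemma vanishing_homologyE:
  assumes "vanishing_homology K i" "simplicial_complex V K"
    and "c \<in> chains K i" "boundary_in V c = (\<lambda>F. 0)"
  obtains d where "d \<in> chains K (i + 1)" "boundary_in V d = c"
  using assms(1,3,4) unfolding vanishing_homology_def cycles_eq[OF assms(2)] boundaries_eq[OF assms(2)]
  by blast

lemma vanishing_homology_no_faces:
  assumes "simplicial_complex V K" "\<And>F. F \<in> K \<Longrightarrow> int (card F) \<noteq> i + 1"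
  shows "vanishing_homology K i"
proof (rule vanishing_homologyI[OF assms(1)])
  fix c assume "c \<in> chains K i"
  then have "c = (\<lambda>F. 0)"
    using assms(2) by (force simp: chains_def)
  then show "\<exists>d\<in>chains K (i + 1). boundary_in V d = c"
    using boundary_in_zero zero_in_chains by blast
qed

lemma vanishing_homology_cone:
  assumes K: "simplicial_complex V K" and v: "v \<in> V" "\<And>F. F \<in> K \<Longrightarrow> insert v F \<in> K"
  shows "vanishing_homology K i"
proof (rule vanishing_homologyI[OF K])
  fix c assume c: "c \<in> chains K i" and cycle: "boundary_in V c = (\<lambda>F. 0)"
  have "finite V"
    using K by (simp add: simplicial_complex_def)
  \<comment> \<open>The part of \<open>c\<close> that avoids \<open>v\<close>, joined to the apex
    \<open>v\<close>. The faces of \<open>c\<close> through \<open>v\<close> need no treatment,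
    since the cycle condition determines their coefficients.\<close>
  define d where "d F = (if v \<in> F then c (F - {v}) else 0)" for F
  have "F \<in> K \<and> int (card F) = i + 1 + 1" if "d F \<noteq> 0" for F
  proof -
    have F: "v \<in> F" "F - {v} \<in> K" "int (card (F - {v})) = i + 1"
      using that c by (auto simp: d_def chains_def split: if_splits)
    then have "F \<in> K"
      using v(2)[OF F(2)] by (simp add: insert_absorb)
    moreover have "finite F"
      using \<open>F \<in> K\<close> K by (auto simp: simplicial_complex_def intro: finite_subset)
    then have "card F = Suc (card (F - {v}))"
      using F(1) by (rule card.remove)
    then have "int (card F) = i + 1 + 1"
      using F(3) by linarith
    ultimately show ?thesis
      by blast
  qed
  then have "d \<in> chains K (i + 1)"
    by (simp add: chains_def)
  moreover have "boundary_in V d G = c G" for G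
  proof (cases "v \<in> G")
    case False
    have "boundary_in V d G = (\<Sum>w\<in>V - G. if w = v then c G else 0)"
      unfolding boundary_in_def d_def using False by (intro sum.cong) auto
    then show ?thesis
      using False v(1) \<open>finite V\<close> by simp
  next
    case True
    \<comment> \<open>The cycle condition is read at \<open>G - {v}\<close>: putting
      \<open>v\<close> back gives \<open>c G\<close>, and any other vertex gives a term of the
      boundary of \<open>d\<close> at \<open>G\<close>.\<close>
    have "0 = boundary_in V c (G - {v})"
      by (simp add: cycle)
    also have "V - (G - {v}) = insert v (V - G)"
      using True v(1) by auto
    then have "boundary_in V c (G - {v}) = c G + (\<Sum>w\<in>V - G. c (insert w (G - {v})))"
      unfolding boundary_in_def using True \<open>finite V\<close> by (simp add: insert_absorb)
    also have "(\<Sum>w\<in>V - G. c (insert w (G - {v}))) = boundary_in V d G"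
      unfolding boundary_in_def d_def using True
      by (intro sum.cong) (auto simp: insert_Diff_if)
    finally show ?thesis
      by (simp only: bit_add_eq_0_iff eq_commute[of 0])
  qed
  ultimately show "\<exists>d\<in>chains K (i + 1). boundary_in V d = c"
    by blast
qed

text \<open>A simplex with a vertex is a cone. The one without vertices is \<open>{{}}\<close>,
  which has homology in dimension -1.\<close>

lemma vanishing_homology_simplex:
  assumes "finite W" "W \<noteq> {} \<or> i \<ge> 0"
  shows "vanishing_homology (Pow W) i"
proof (cases "W = {}")
  case True
  then show ?thesis
    using assms by (intro vanishing_homology_no_faces[of W]) (auto simp: simplicial_complex_def)
next
  case False
  then obtain v where "v \<in> W"
    by blast
  then show ?thesis
    using assms by (intro vanishing_homology_cone[of W _ v]) (auto simp: simplicial_complex_def)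
qed

text \<open>The needed piece of Mayer-Vietoris, on chains. Split a cycle as \<open>a + b\<close>
  with \<open>a\<close> in \<open>K\<close> and \<open>b\<close> in \<open>L\<close>. Their
  boundaries agree, hence lie in \<open>K \<inter> L\<close> and bound some \<open>x\<close> there.
  Then \<open>a + x\<close> and \<open>b + x\<close> are cycles that can be filled separately, and
  modulo 2 the two copies of \<open>x\<close> cancel.\<close>

lemma vanishing_homology_Un:
  assumes K: "simplicial_complex V K" and L: "simplicial_complex V L"
    and van: "vanishing_homology K i" "vanishing_homology L i" "vanishing_homology (K \<inter> L) (i - 1)"
  shows "vanishing_homology (K \<union> L) i"
proof -
  have KL: "simplicial_complex V (K \<union> L)" "simplicial_complex V (K \<inter> L)"
    using K L by (auto simp: simplicial_complex_def)
  show ?thesis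
  proof (rule vanishing_homologyI[OF KL(1)])
    fix c assume c: "c \<in> chains (K \<union> L) i" and cycle: "boundary_in V c = (\<lambda>F. 0)"
    define a where "a F = (if F \<in> K then c F else 0)" for F
    define b where "b F = (if F \<in> K then 0 else c F)" for F
    have a: "a \<in> chains K i" and b: "b \<in> chains L i"
      using c by (auto simp: a_def b_def chains_def)
    have c_eq: "c = (\<lambda>F. a F + b F)"
      by (auto simp: a_def b_def)
    have bd_eq: "boundary_in V a = boundary_in V b"
    proof
      fix G
      have "boundary_in V a G + boundary_in V b G = 0"
        using fun_cong[OF cycle, of G] unfolding c_eq boundary_in_add .
      then show "boundary_in V a G = boundary_in V b G"
        by (simp only: bit_add_eq_0_iff)
    qed
    have "boundary_in V a \<in> chains (K \<inter> L) (i - 1)"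
      using boundary_in_chains[OF K a] boundary_in_chains[OF L b] bd_eq by (auto simp: chains_def)
    then obtain x where x: "x \<in> chains (K \<inter> L) i" "boundary_in V x = boundary_in V a"
      using vanishing_homologyE[OF van(3) KL(2), of "boundary_in V a"]
        boundary_in_boundary_in[of V a] K by (auto simp: simplicial_complex_def)
    have xKL: "x \<in> chains K i" "x \<in> chains L i"
      using x(1) by (auto simp: chains_def)
    obtain p where p: "p \<in> chains K (i + 1)" "boundary_in V p = (\<lambda>F. a F + x F)"
      by (rule vanishing_homologyE[OF van(1) K add_in_chains[OF a xKL(1)]])
        (simp add: boundary_in_add x(2))
    obtain q where q: "q \<in> chains L (i + 1)" "boundary_in V q = (\<lambda>F. b F + x F)"
      by (rule vanishing_homologyE[OF van(2) L add_in_chains[OF b xKL(2)]])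
        (simp add: boundary_in_add x(2) bd_eq)
    have "(a F + x F) + (b F + x F) = (a F + b F) + (x F + x F)" for F
      by (simp only: ac_simps)
    then have "(a F + x F) + (b F + x F) = c F" for F
      unfolding c_eq by simp
    then have "boundary_in V (\<lambda>F. p F + q F) = c"
      by (simp add: boundary_in_add p q)
    moreover have "(\<lambda>F. p F + q F) \<in> chains (K \<union> L) (i + 1)"
      using p(1) q(1) chains_mono[of K "K \<union> L"] chains_mono[of L "K \<union> L"]
      by (intro add_in_chains) auto
    ultimately show "\<exists>d\<in>chains (K \<union> L) (i + 1). boundary_in V d = c"
      by blast
  qed
qed

text \<open>No face has dimension 0, so nothing bounds the empty face. This forces every Leray
  integer of a non-void complex to be nonnegative.\<close>

lemma not_vanishing_homology_empty_face: "\<not> vanishing_homology {{} :: 'a set} (-1)"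
proof
  assume van: "vanishing_homology {{} :: 'a set} (-1)"
  have K: "simplicial_complex {} {{} :: 'a set}"
    by (simp add: simplicial_complex_def)
  define c :: "'a set \<Rightarrow> bit" where "c F = (if F = {} then 1 else 0)" for F
  have "c \<in> chains {{}} (-1)" "boundary_in {} c = (\<lambda>F. 0)"
    by (auto simp: chains_def c_def boundary_in_def)
  then obtain d where "boundary_in {} d = c"
    by (rule vanishing_homologyE[OF van K])
  then have "c {} = 0"
    by (auto simp: boundary_in_def)
  then show False
    by (simp add: c_def)
qed

lemma Leray_number_le:
  assumes K: "simplicial_complex V K" and "is_Leray V K d"
  shows "Leray_number V K \<le> ereal (real_of_int d)"
proof (cases "K = {}")
  case True
  then show ?thesis
    by (simp add: Leray_number_def)
next
  case False
  have nonneg: "d' \<ge> 0" if "is_Leray V K d'" for d'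
  proof (rule ccontr)
    assume "\<not> d' \<ge> 0"
    then have "trivial_group (reduced_homology (induced_subcomplex K {}) (-1))"
      using that by (auto simp: is_Leray_def)
    moreover have "induced_subcomplex K {} = {{}}"
      using False K by (auto simp: induced_subcomplex_def simplicial_complex_def)
    ultimately show False
      using trivial_reduced_homology_iff[of "{}" "{{}}"] not_vanishing_homology_empty_face
      by (auto simp: simplicial_complex_def)
  qed
  \<comment> \<open>\<open>LEAST\<close> on \<open>int\<close> is meaningful only with a lower
    bound. Since all Leray integers are nonnegative here, the minimum is found in \<open>nat\<close>
    and carried over.\<close>
  define m where "m = (LEAST k. is_Leray V K (int k))"
  have "is_Leray V K (int (nat d))"
    using assms(2) nonneg by simp
  then have m: "is_Leray V K (int m)" "m \<le> nat d"
    unfolding m_def by (rule LeastI, rule Least_le)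
  have "(LEAST d. is_Leray V K d) = int m"
  proof (rule Least_equality)
    fix d' assume "is_Leray V K d'"
    moreover have "m \<le> nat d'"
      unfolding m_def using calculation nonneg by (intro Least_le) simp
    ultimately show "int m \<le> d'"
      using nonneg by fastforce
  qed (rule m)
  then show ?thesis
    using False m(2) nonneg[OF assms(2)] by (simp add: Leray_number_def)
qed

section \<open>Noncover complexes\<close>

text \<open>Edges with equal traces merge, and an edge disjoint from \<open>W\<close> leaves the
  empty set, which is not a legal edge.\<close>

definition trace :: "'a set set \<Rightarrow> 'a set \<Rightarrow> 'a set set" where
  "trace H W = (\<lambda>e. e \<inter> W) ` H"

definition no_isolated :: "'a set \<Rightarrow> 'a set set \<Rightarrow> bool" where
  "no_isolated V H \<longleftrightarrow> hypergraph V H \<and> (\<forall>v\<in>V. \<not> isolated H v)"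

definition antichain :: "'a set set \<Rightarrow> bool" where
  "antichain H \<longleftrightarrow> (\<forall>e\<in>H. \<forall>f\<in>H. e \<subseteq> f \<longrightarrow> e = f)"

lemma mem_noncover_complex:
  "F \<in> noncover_complex V H \<longleftrightarrow> F \<subseteq> V \<and> (\<exists>e\<in>H. F \<inter> e = {})"
  by (simp add: noncover_complex_def cover_def)

lemma simplicial_complex_noncover:
  assumes "hypergraph V H"
  shows "simplicial_complex V (noncover_complex V H)"
proof -
  have "G \<in> noncover_complex V H" if F: "F \<in> noncover_complex V H" and G: "G \<subseteq> F" for F G
  proof -
    obtain e where "e \<in> H" "F \<inter> e = {}" "F \<subseteq> V"
      using F by (auto simp: mem_noncover_complex)
    moreover from this have "G \<inter> e = {}" "G \<subseteq> V"
      using G by auto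
    ultimately show ?thesis
      by (auto simp: mem_noncover_complex)
  qed
  moreover have "noncover_complex V H \<subseteq> Pow V"
    by (auto simp: mem_noncover_complex)
  moreover have "finite V"
    using assms by (simp add: hypergraph_def)
  ultimately show ?thesis
    unfolding simplicial_complex_def by (intro conjI ballI allI impI)
qed

text \<open>A subset of \<open>W\<close> misses \<open>e\<close> iff it misses
  \<open>e \<inter> W\<close>. This serves both for the intersection with the simplex on
  \<open>V - e\<close> and for induced subcomplexes.\<close>

lemma noncover_complex_trace:
  assumes "W \<subseteq> V"
  shows "noncover_complex V H \<inter> Pow W = noncover_complex W (trace H W)"
proof -
  have "F \<inter> (e \<inter> W) = F \<inter> e" if "F \<subseteq> W" for F e
    using that by auto
  then have "F \<in> noncover_complex V H \<inter> Pow W \<longleftrightarrow> F \<in> noncover_complex W (trace H W)" for F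
    using assms by (cases "F \<subseteq> W") (simp_all add: mem_noncover_complex trace_def subset_trans[of F W V])
  then show ?thesis
    by blast
qed

lemma noncover_complex_delete_edge:
  assumes "e \<in> H"
  shows "noncover_complex V H = noncover_complex V (H - {e}) \<union> Pow (V - e)"
  using assms by (auto simp: mem_noncover_complex) blast+

lemma noncover_complex_delete_superset:
  assumes "e \<in> H" "e \<subseteq> f" "e \<noteq> f"
  shows "noncover_complex V H = noncover_complex V (H - {f})"
  using assms by (auto simp: mem_noncover_complex) blast

lemma vanishing_homology_noncover_isolated:
  assumes H: "hypergraph V H" and v: "v \<in> V" "isolated H v"
  shows "vanishing_homology (noncover_complex V H) i"
  by (rule vanishing_homology_cone[OF simplicial_complex_noncover[OF H] v(1)])
    (use v in \<open>auto simp: mem_noncover_complex isolated_def\<close>)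

lemma no_isolated_edge:
  assumes "no_isolated V H" "v \<in> V"
  obtains e where "e \<in> H" "v \<in> e"
  using assms by (auto simp: no_isolated_def isolated_def)

lemma no_isolated_nonempty:
  assumes "no_isolated V H" "V \<noteq> {}"
  obtains e where "e \<in> H"
proof -
  obtain v where "v \<in> V"
    using assms(2) by blast
  then show ?thesis
    using no_isolated_edge[OF assms(1)] that by blast
qed

lemma no_isolated_choice:
  assumes "no_isolated V H"
  obtains f where "\<And>v. v \<in> V \<Longrightarrow> f v \<in> H \<and> v \<in> f v"
proof -
  have "\<forall>v\<in>V. \<exists>e. e \<in> H \<and> v \<in> e"
    using no_isolated_edge[OF assms] by blast
  then show ?thesis
    using that bchoice[of V "\<lambda>v e. e \<in> H \<and> v \<in> e"] by blast
qed

lemma edge_subset: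
  assumes "no_isolated V H" "e \<in> H"
  shows "e \<subseteq> V"
  using assms by (auto simp: no_isolated_def hypergraph_def)

lemma edge_nonempty:
  assumes "no_isolated V H" "e \<in> H"
  shows "e \<noteq> {}"
  using assms by (auto simp: no_isolated_def hypergraph_def)

lemma finite_edge:
  assumes "no_isolated V H" "e \<in> H"
  shows "finite e"
  using assms by (auto simp: no_isolated_def hypergraph_def dest: finite_subset)

lemma no_isolated_finite:
  assumes "no_isolated V H"
  shows "finite V" "finite H"
proof -
  show "finite V"
    using assms by (simp add: no_isolated_def hypergraph_def)
  moreover have "H \<subseteq> Pow V"
    using assms by (auto simp: no_isolated_def hypergraph_def)
  ultimately show "finite H"
    using finite_subset by blast
qed

lemma noncover_complex_empty_vertex_set:
  assumes "no_isolated {} H"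
  shows "noncover_complex {} H = {}"
proof -
  have "H = {}"
    using edge_subset[OF assms] edge_nonempty[OF assms] by auto
  then show ?thesis
    by (simp add: noncover_complex_def cover_def)
qed

lemma no_isolated_trace:
  assumes H: "hypergraph V H" and W: "W \<subseteq> V"
    and meets: "\<And>e. e \<in> H \<Longrightarrow> e \<inter> W \<noteq> {}" and incident: "\<And>w. w \<in> W \<Longrightarrow> \<exists>e\<in>H. w \<in> e"
  shows "no_isolated W (trace H W)"
  unfolding no_isolated_def hypergraph_def
proof (intro conjI ballI)
  show "finite W"
    using H W by (auto simp: hypergraph_def dest: finite_subset)
next
  fix e assume "e \<in> trace H W"
  then show "e \<subseteq> W" "e \<noteq> {}"
    using meets by (auto simp: trace_def)
next
  fix w assume "w \<in> W"
  then obtain e where "e \<in> H" "w \<in> e"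
    using incident by blast
  then have "e \<inter> W \<in> trace H W" "w \<in> e \<inter> W"
    using \<open>w \<in> W\<close> by (simp_all add: trace_def)
  then show "\<not> isolated (trace H W) w"
    unfolding isolated_def by blast
qed

text \<open>An edge inside \<open>e\<close> would leave an empty trace; the antichain excludes this.
  A vertex outside \<open>e\<close> keeps its edges, as none of them is \<open>e\<close>.\<close>

lemma no_isolated_contract:
  assumes H: "no_isolated V H" and anti: "antichain H" and e: "e \<in> H"
  shows "no_isolated (V - e) (trace (H - {e}) (V - e))"
proof (rule no_isolated_trace)
  show "hypergraph V (H - {e})"
    using H by (simp add: no_isolated_def hypergraph_def)
next
  fix f assume f: "f \<in> H - {e}"
  then have "\<not> f \<subseteq> e"
    using anti e unfolding antichain_def by blast
  then obtain x where "x \<in> f" "x \<notin> e"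
    by blast
  moreover from this have "x \<in> V"
    using edge_subset[OF H, of f] f by auto
  ultimately show "f \<inter> (V - e) \<noteq> {}"
    by blast
next
  fix w assume w: "w \<in> V - e"
  then obtain f where "f \<in> H" "w \<in> f"
    using no_isolated_edge[OF H] by blast
  then show "\<exists>f\<in>H - {e}. w \<in> f"
    using w by (intro bexI[of _ f]) auto
qed blast

lemma card_trace_less:
  assumes "finite H" "e \<in> H"
  shows "card (trace (H - {e}) W) < card H"
proof -
  have "card (trace (H - {e}) W) \<le> card (H - {e})"
    using assms(1) unfolding trace_def by (intro card_image_le) simp
  also have "\<dots> < card H"
    using assms by (rule card_Diff1_less)
  finally show ?thesis .
qed

section \<open>The induction on the number of edges\<close>

text \<open>\<open>D V H n\<close> is meant to say that \<open>n\<close> is at most a given domination parameter of \<open>H\<close>;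
  the bound is an integer because it may become negative in \<open>contract\<close> and \<open>restrict\<close>.\<close>

locale noncover_bound =
  fixes D :: "'a set \<Rightarrow> 'a set set \<Rightarrow> int \<Rightarrow> bool"
  assumes mono: "\<lbrakk>G \<subseteq> H; D V H n\<rbrakk> \<Longrightarrow> D V G n"
    and less_card: "\<lbrakk>no_isolated V H; V \<noteq> {}; D V H n\<rbrakk> \<Longrightarrow> n < int (card V)"
    and contract: "\<lbrakk>no_isolated V H; V \<noteq> {}; antichain H; D V H n\<rbrakk>
      \<Longrightarrow> \<exists>e\<in>H. D (V - e) (trace (H - {e}) (V - e)) (n + 1 - int (card e))"
    and restrict: "\<lbrakk>no_isolated V H; W \<subseteq> V; \<And>e. e \<in> H \<Longrightarrow> e \<inter> W \<noteq> {}; D V H n\<rbrakk>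
      \<Longrightarrow> D W (trace H W) (n - int (card (V - W)))"
begin

lemma vanishing_homology_noncover:
  assumes "no_isolated V H" "D V H n" "int (card V) - n - 1 \<le> i"
  shows "vanishing_homology (noncover_complex V H) i"
  using assms
proof (induction "card H" arbitrary: V H n i rule: less_induct)
  case less
  note H = less.prems(1) and D = less.prems(2) and i = less.prems(3)
  note fin = no_isolated_finite[OF H]
  have hyp: "hypergraph V (H - {f})" for f
    using H by (auto simp: no_isolated_def hypergraph_def)
  \<comment> \<open>Deletion keeps \<open>V\<close>, and by \<open>mono\<close> also
    \<open>n\<close>, so the threshold does not move. This is used both for reaching an antichain
    and for the first part of the union.\<close>
  have delete: "vanishing_homology (noncover_complex V (H - {f})) i" if "f \<in> H" for f
  proof (cases "\<exists>v\<in>V. isolated (H - {f}) v")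
    case True
    then show ?thesis
      using vanishing_homology_noncover_isolated[OF hyp] by blast
  next
    case False
    then have "no_isolated V (H - {f})"
      using hyp by (simp add: no_isolated_def)
    moreover have "card (H - {f}) < card H"
      using fin(2) that by (rule card_Diff1_less)
    moreover have "D V (H - {f}) n"
      using D by (auto intro: mono)
    ultimately show ?thesis
      using less.hyps i by blast
  qed
  show ?case
  proof (cases "antichain H")
    case False
    then obtain e f where "e \<in> H" "f \<in> H" "e \<subseteq> f" "e \<noteq> f"
      by (auto simp: antichain_def)
    then show ?thesis
      using delete noncover_complex_delete_superset by metis
  next
    case antichain: True
    show ?thesis
    proof (cases "V = {}")
      case True
      then have "noncover_complex V H = {}"
        using H noncover_complex_empty_vertex_set by auto
      then show ?thesis
        using vanishing_homology_no_faces[of "{}" "{}" i] by (simp add: simplicial_complex_def)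
    next
      case False
      obtain e where e: "e \<in> H"
        and De: "D (V - e) (trace (H - {e}) (V - e)) (n + 1 - int (card e))"
        using contract[OF H False antichain D] by blast
      let ?W = "V - e"
      have "card ?W = card V - card e" "card e \<le> card V"
        using edge_subset[OF H e] finite_edge[OF H e] fin by (simp_all add: card_Diff_subset card_mono)
      \<comment> \<open>The loss of |e| vertices against |e| - 1 in the bound lowers the threshold
        by exactly one, matching the degree shift in \<open>vanishing_homology_Un\<close>.\<close>
      then have "int (card ?W) - (n + 1 - int (card e)) - 1 \<le> i - 1"
        using i by linarith
      then have link: "vanishing_homology (noncover_complex ?W (trace (H - {e}) ?W)) (i - 1)"
        using less.hyps[OF card_trace_less[OF fin(2) e] no_isolated_contract[OF H antichain e] De]
        by blast
      have "vanishing_homology (noncover_complex V (H - {e}) \<union> Pow ?W) i"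
      proof (rule vanishing_homology_Un[of V])
        show "simplicial_complex V (Pow ?W)"
          using fin by (auto simp: simplicial_complex_def)
        \<comment> \<open>The delicate case is \<open>e = V\<close>, where the simplex is
          \<open>{{}}\<close>; \<open>less_card\<close> makes \<open>i\<close> nonnegative and so
          avoids its homology in dimension -1.\<close>
        show "vanishing_homology (Pow ?W) i"
          using less_card[OF H False D] i fin by (intro vanishing_homology_simplex) auto
        show "vanishing_homology (noncover_complex V (H - {e}) \<inter> Pow ?W) (i - 1)"
          using link by (simp add: noncover_complex_trace)
      qed (use delete[OF e] simplicial_complex_noncover[OF hyp] in auto)
      then show ?thesis
        using noncover_complex_delete_edge[OF e] by simp
    qed
  qed
qed

lemma Leray_number_noncover_le:
  assumes H: "no_isolated V H" and D: "D V H n"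
  shows "Leray_number V (noncover_complex V H) \<le> ereal (real_of_int (int (card V) - n - 1))"
proof (cases "V = {}")
  case True
  then have "noncover_complex V H = {}"
    using H noncover_complex_empty_vertex_set by auto
  then show ?thesis
    by (simp add: Leray_number_def)
next
  case False
  have hyp: "hypergraph V H"
    using H by (simp add: no_isolated_def)
  note fin = no_isolated_finite[OF H]
  show ?thesis
  proof (rule Leray_number_le[OF simplicial_complex_noncover[OF hyp]], unfold is_Leray_def, intro allI impI)
    fix i W assume i: "int (card V) - n - 1 \<le> i" and W: "W \<subseteq> V"
    let ?K = "induced_subcomplex (noncover_complex V H) W"
    have K: "?K = noncover_complex V H \<inter> Pow W"
      by (auto simp: induced_subcomplex_def)
    have "vanishing_homology ?K i"
    proof (cases "\<exists>e\<in>H. e \<inter> W = {}")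
      case True
      then obtain e where e: "e \<in> H" "e \<inter> W = {}"
        by blast
      \<comment> \<open>All subsets of \<open>W\<close> miss \<open>e\<close>, so the induced
        subcomplex is a full simplex; \<open>less_card\<close> again gives \<open>i \<ge> 0\<close>,
        which covers \<open>W = {}\<close>.\<close>
      have "F \<in> noncover_complex V H" if "F \<subseteq> W" for F
      proof -
        have "F \<inter> e = {}" "F \<subseteq> V"
          using e(2) W that by auto
        then show ?thesis
          using e(1) by (auto simp: mem_noncover_complex)
      qed
      then have "?K = Pow W"
        unfolding K by blast
      moreover have "finite W"
        using W fin finite_subset by blast
      ultimately show ?thesis
        using less_card[OF H False D] i by (simp add: vanishing_homology_simplex)
    next
      case cover: False
      then have meets: "e \<inter> W \<noteq> {}" if "e \<in> H" for e
        using that by blast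
      have incident: "\<exists>e\<in>H. w \<in> e" if "w \<in> W" for w
        using no_isolated_edge[OF H] that W by blast
      have "finite W"
        using W fin finite_subset by blast
      then have "card (V - W) = card V - card W" "card W \<le> card V"
        using W fin by (simp_all add: card_Diff_subset card_mono)
      \<comment> \<open>Vertices and bound both drop by |V - W|, so the threshold is
        unchanged.\<close>
      then have bound: "int (card W) - (n - int (card (V - W))) - 1 \<le> i"
        using i by linarith
      show ?thesis
        unfolding K noncover_complex_trace[OF W]
        by (rule vanishing_homology_noncover[OF no_isolated_trace[OF hyp W meets incident]
            restrict[OF H W meets D] bound])
    qed
    moreover have "simplicial_complex V ?K"
      using simplicial_complex_noncover[OF hyp] unfolding K by (auto simp: simplicial_complex_def)
    ultimately show "trivial_group (reduced_homology ?K i)"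
      by (simp add: trivial_reduced_homology_iff)
  qed
qed

end

section \<open>Domination bounds\<close>

lemma dominates_vertex_iff:
  "dominates_vertex H U v \<longleftrightarrow> (\<exists>e\<in>H. v \<in> e \<and> e - {v} \<subseteq> U)"
proof
  assume "dominates_vertex H U v"
  then obtain U' where "U' \<subseteq> U - {v}" "U' \<union> {v} \<in> H"
    by (auto simp: dominates_vertex_def)
  then show "\<exists>e\<in>H. v \<in> e \<and> e - {v} \<subseteq> U"
    by (intro bexI[of _ "U' \<union> {v}"]) auto
next
  assume "\<exists>e\<in>H. v \<in> e \<and> e - {v} \<subseteq> U"
  then obtain e where "e \<in> H" "v \<in> e" "e - {v} \<subseteq> U"
    by blast
  then show "dominates_vertex H U v"
    unfolding dominates_vertex_def by (intro exI[of _ "e - {v}"]) (auto simp: insert_absorb)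
qed

lemma dominates_iff:
  "dominates H U A \<longleftrightarrow> (\<forall>v\<in>A. \<exists>e\<in>H. v \<in> e \<and> e - {v} \<subseteq> U)"
  by (simp add: dominates_def dominates_vertex_iff)

lemma dominates_trace_iff:
  assumes "A \<subseteq> W"
  shows "dominates (trace H W) U A \<longleftrightarrow> (\<forall>v\<in>A. \<exists>e\<in>H. v \<in> e \<and> e \<inter> W - {v} \<subseteq> U)"
  using assms by (auto simp: dominates_iff trace_def)

lemma dominates_mono:
  assumes "dominates H U A" "G \<supseteq> H" "U \<subseteq> U'"
  shows "dominates G U' A"
  using assms unfolding dominates_iff by (meson subset_trans subsetD)

lemma dominates_self:
  assumes "no_isolated V H" "V \<subseteq> U"
  shows "dominates H U V"
  unfolding dominates_iff
proof
  fix v assume "v \<in> V"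
  then obtain e where "e \<in> H" "v \<in> e"
    using no_isolated_edge[OF assms(1)] by blast
  moreover from this have "e - {v} \<subseteq> U"
    using edge_subset[OF assms(1)] assms(2) by blast
  ultimately show "\<exists>e\<in>H. v \<in> e \<and> e - {v} \<subseteq> U"
    by blast
qed

text \<open>The edge \<open>e\<close> dominates its own vertices, and adding \<open>e\<close> to
  \<open>U\<close> restores what the traces cut off from the other edges.\<close>

lemma dominates_contract:
  assumes H: "no_isolated V H" "e \<in> H"
    and U: "dominates (trace (H - {e}) (V - e)) U (V - e)"
  shows "dominates H (U \<union> e) V"
  unfolding dominates_iff
proof
  fix v assume "v \<in> V"
  show "\<exists>f\<in>H. v \<in> f \<and> f - {v} \<subseteq> U \<union> e"
  proof (cases "v \<in> e")
    case True
    then show ?thesis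
      using H by blast
  next
    case False
    then obtain f where "f \<in> H" "v \<in> f" "f \<inter> (V - e) - {v} \<subseteq> U"
      using U \<open>v \<in> V\<close> by (auto simp: dominates_trace_iff)
    then show ?thesis
      using edge_subset[OF H(1), of f] by blast
  qed
qed

text \<open>The vertex \<open>x\<close> is dominated by the empty set, and in an antichain no other
  edge contains \<open>x\<close>, so the traces are the edges themselves and nothing must be added
  to \<open>U\<close>.\<close>

lemma dominates_contract_loop:
  assumes H: "no_isolated V H" "antichain H" "{x} \<in> H"
    and U: "dominates (trace (H - {{x}}) (V - {x})) U (V - {x})"
  shows "dominates H U V"
  unfolding dominates_iff
proof
  fix v assume "v \<in> V"
  show "\<exists>f\<in>H. v \<in> f \<and> f - {v} \<subseteq> U"
  proof (cases "v = x")
    case True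
    then show ?thesis
      using H by (intro bexI[of _ "{x}"]) auto
  next
    case False
    then obtain f where f: "f \<in> H - {{x}}" "v \<in> f" "f \<inter> (V - {x}) - {v} \<subseteq> U"
      using U \<open>v \<in> V\<close> by (auto simp: dominates_trace_iff)
    then have "x \<notin> f"
      using H by (auto simp: antichain_def)
    then show ?thesis
      using f edge_subset[OF H(1), of f] by blast
  qed
qed

lemma card_trace_edges:
  assumes "no_isolated V H" "\<forall>e\<in>H. card e \<le> k" "G \<subseteq> H"
  shows "\<forall>e\<in>trace G W. card e \<le> k"
proof
  fix e assume "e \<in> trace G W"
  then obtain f where "f \<in> H" "e = f \<inter> W"
    using assms by (auto simp: trace_def)
  then have "card e \<le> card f"
    using finite_edge[OF assms(1)] by (simp add: card_mono)
  then show "card e \<le> k"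
    using assms(2) \<open>f \<in> H\<close> by fastforce
qed

lemma loop_cases:
  assumes "no_isolated V H" "e \<in> H"
  obtains x where "e = {x}" | "card e \<ge> 2"
proof -
  have "card e \<noteq> 0"
    using edge_nonempty[OF assms] finite_edge[OF assms] by simp
  then show ?thesis
    using that card_1_singletonE[of e] by (metis One_nat_def Suc_leI le_neq_implies_less neq0_conv
        numeral_2_eq_2)
qed

lemma card_UN_bound:
  assumes "finite Z" "\<And>z. z \<in> Z \<Longrightarrow> card (S z) \<le> k"
  shows "card (\<Union>z\<in>Z. S z) \<le> k * card Z"
proof -
  have "card (\<Union>z\<in>Z. S z) \<le> (\<Sum>z\<in>Z. card (S z))"
    using assms(1) by (rule card_UN_le)
  also have "\<dots> \<le> (\<Sum>z\<in>Z. k)"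
    using assms(2) by (rule sum_mono)
  finally show ?thesis
    by (simp add: mult.commute)
qed

section \<open>Strong total domination, for (a)\<close>

text \<open>For integers, \<open>2 * n \<le> k + 1\<close> is equivalent to \<open>n \<le> \<lceil>k / 2\<rceil>\<close>.\<close>

definition total_bound :: "'a set \<Rightarrow> 'a set set \<Rightarrow> int \<Rightarrow> bool" where
  "total_bound V H n \<longleftrightarrow>
     (\<forall>e\<in>H. card e \<le> 3) \<and> (\<forall>U\<subseteq>V. dominates H U V \<longrightarrow> 2 * n \<le> int (card U) + 1)"

text \<open>As \<open>2 * n\<close> is compared with the size of \<open>U\<close>, each removed
  vertex may cost two. Adding every removed vertex together with the rest of an edge through it
  could cost three, so one has to be saved.\<close>

lemma total_bound_restrict:
  assumes H: "no_isolated V H" and W: "W \<subseteq> V" and D: "total_bound V H n"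
  shows "total_bound W (trace H W) (n - int (card (V - W)))"
  unfolding total_bound_def
proof (intro conjI allI impI)
  show "\<forall>e\<in>trace H W. card e \<le> 3"
    using D by (intro card_trace_edges[OF H]) (auto simp: total_bound_def)
next
  fix U assume U: "U \<subseteq> W" and dom: "dominates (trace H W) U W"
  let ?Z = "V - W"
  have fin: "finite ?Z" "finite U"
    using no_isolated_finite[OF H] U W by (auto dest: finite_subset)
  \<comment> \<open>A removed vertex that helps to dominate some \<open>w \<in> W\<close> through an edge is paid for by itself
    and \<open>w\<close>, which together complete that edge; any other one is left out, and is paid for by the
    at most two further vertices of an edge containing it.\<close>
  define used where "used z \<longleftrightarrow> (\<exists>e\<in>H. z \<in> e \<and> (\<exists>w\<in>e \<inter> W. e - {w} \<subseteq> U \<union> ?Z))" for z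
  define good where "good z S \<longleftrightarrow> S \<subseteq> V \<and> card S \<le> 2 \<and> (used z \<longrightarrow> z \<in> S) \<and>
      (\<exists>e\<in>H. z \<in> e \<and> e - {z} \<subseteq> U \<union> {y \<in> ?Z. used y} \<union> S)" for z S
  have "\<exists>S. good z S" if z: "z \<in> ?Z" for z
  proof (cases "used z")
    case True
    then obtain e w where e: "e \<in> H" "z \<in> e" "w \<in> e \<inter> W" "e - {w} \<subseteq> U \<union> ?Z"
      by (auto simp: used_def)
    \<comment> \<open>The same \<open>e\<close> and \<open>w\<close> show that all removed vertices
      of \<open>e\<close> are used, so only \<open>w\<close> can be missing from
      \<open>e - {z}\<close>.\<close>
    then have "used y" if "y \<in> e \<inter> ?Z" for y
      using that unfolding used_def by blast
    then have "e - {z} \<subseteq> U \<union> {y \<in> ?Z. used y} \<union> {z, w}"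
      using e by blast
    moreover have "card {z, w} \<le> 2"
      by (simp add: card_insert_if)
    moreover have "{z, w} \<subseteq> V"
      using e(3) z W by blast
    ultimately have "good z {z, w}"
      unfolding good_def using e(1,2) by blast
    then show ?thesis ..
  next
    case False
    obtain e where e: "e \<in> H" "z \<in> e"
      using z no_isolated_edge[OF H] by blast
    then have "card (e - {z}) \<le> 2"
      using D by (fastforce simp: total_bound_def card_Diff_singleton_if)
    moreover have "e - {z} \<subseteq> V"
      using edge_subset[OF H e(1)] by blast
    ultimately have "good z (e - {z})"
      unfolding good_def using False e by blast
    then show ?thesis ..
  qed
  then have "\<forall>z\<in>?Z. \<exists>S. good z S"
    by blast
  from bchoice[OF this] obtain S where "\<forall>z\<in>?Z. good z (S z)" ..
  then have S: "S z \<subseteq> V" "card (S z) \<le> 2" "used z \<Longrightarrow> z \<in> S z"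
      "\<exists>e\<in>H. z \<in> e \<and> e - {z} \<subseteq> U \<union> {y \<in> ?Z. used y} \<union> S z" if "z \<in> ?Z" for z
    using that by (simp_all add: good_def)
  define U' where "U' = U \<union> (\<Union>z\<in>?Z. S z)"
  have used: "{y \<in> ?Z. used y} \<subseteq> U'"
    using S(3) by (auto simp: U'_def)
  have "dominates H U' V"
    unfolding dominates_iff
  proof
    fix v assume "v \<in> V"
    show "\<exists>e\<in>H. v \<in> e \<and> e - {v} \<subseteq> U'"
    proof (cases "v \<in> W")
      case True
      then obtain e where e: "e \<in> H" "v \<in> e" "e \<inter> W - {v} \<subseteq> U"
        using dom by (auto simp: dominates_trace_iff)
      \<comment> \<open>Here \<open>v\<close> itself plays the part of \<open>w\<close>: the removed
        vertices of \<open>e\<close> are used, hence already in \<open>U'\<close>.\<close>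
      then have "e - {v} \<subseteq> U \<union> ?Z"
        using edge_subset[OF H e(1)] by blast
      then have "used y" if "y \<in> e \<inter> ?Z" for y
        using e(1,2) True that unfolding used_def by blast
      then have "e - {v} \<subseteq> U \<union> {y \<in> ?Z. used y}"
        using \<open>e - {v} \<subseteq> U \<union> ?Z\<close> by blast
      moreover have "U \<subseteq> U'"
        unfolding U'_def by blast
      ultimately have "e - {v} \<subseteq> U'"
        using used by blast
      then show ?thesis
        using e by blast
    next
      case False
      then obtain e where "e \<in> H" "v \<in> e" "e - {v} \<subseteq> U \<union> {y \<in> ?Z. used y} \<union> S v"
        using S(4)[of v] \<open>v \<in> V\<close> by blast
      moreover have "U \<union> S v \<subseteq> U'"
        using False \<open>v \<in> V\<close> unfolding U'_def by blast
      ultimately have "e - {v} \<subseteq> U'"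
        using used by blast
      then show ?thesis
        using \<open>e \<in> H\<close> \<open>v \<in> e\<close> by blast
    qed
  qed
  moreover have "U' \<subseteq> V"
    using U W S(1) unfolding U'_def by blast
  ultimately have "2 * n \<le> int (card U') + 1"
    using D by (auto simp: total_bound_def)
  moreover have "card U' \<le> card U + 2 * card ?Z"
  proof -
    have "card U' \<le> card U + card (\<Union>z\<in>?Z. S z)"
      unfolding U'_def by (rule card_Un_le)
    also have "card (\<Union>z\<in>?Z. S z) \<le> 2 * card ?Z"
      using S(2) by (intro card_UN_bound fin)
    finally show ?thesis
      by simp
  qed
  then have "int (card U') \<le> int (card U) + 2 * int (card ?Z)"
    by linarith
  ultimately show "2 * (n - int (card ?Z)) \<le> int (card U) + 1"
    by arith
qed

interpretation total: noncover_bound total_bound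
proof
  fix V :: "'a set" and H G n
  assume sub: "G \<subseteq> H" and D: "total_bound V H n"
  have "2 * n \<le> int (card U) + 1" if "U \<subseteq> V" "dominates G U V" for U
    using D that(1) dominates_mono[OF that(2) sub order_refl] by (simp add: total_bound_def)
  moreover have "\<forall>e\<in>G. card e \<le> 3"
    using D sub by (auto simp: total_bound_def)
  ultimately show "total_bound V G n"
    by (simp add: total_bound_def)
next
  fix V :: "'a set" and H n
  assume H: "no_isolated V H" and V: "V \<noteq> {}" and D: "total_bound V H n"
  obtain e where e: "e \<in> H"
    by (rule no_isolated_nonempty[OF H V])
  have "card V \<noteq> 0"
    using no_isolated_finite[OF H] \<open>V \<noteq> {}\<close> by simp
  show "n < int (card V)"
  \<comment> \<open>\<open>U = V\<close> gives \<open>2 * n \<le> int (card V) + 1\<close>, which is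
    too weak for a single vertex. There the only edge is a loop, and the empty set
    dominates.\<close>
  proof (cases "card V = 1")
    case True
    then obtain v where "V = {v}"
      by (rule card_1_singletonE)
    then have "{v} \<in> H"
      using edge_subset[OF H e] edge_nonempty[OF H e] e by (metis subset_singletonD)
    then have "dominates H {} V"
      using \<open>V = {v}\<close> by (force simp: dominates_iff)
    then have "2 * n \<le> 1"
      using D by (force simp: total_bound_def)
    then show ?thesis
      using True by simp
  next
    case False
    have "2 * n \<le> int (card V) + 1"
      using D dominates_self[OF H order_refl] by (auto simp: total_bound_def)
    then show ?thesis
      using False \<open>card V \<noteq> 0\<close> by arith
  qed
next
  fix V :: "'a set" and H n
  assume H: "no_isolated V H" and V: "V \<noteq> {}" and anti: "antichain H" and D: "total_bound V H n"
  obtain e where e: "e \<in> H"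
    by (rule no_isolated_nonempty[OF H V])
  have "total_bound (V - e) (trace (H - {e}) (V - e)) (n + 1 - int (card e))"
    unfolding total_bound_def
  proof (intro conjI allI impI)
    show "\<forall>f\<in>trace (H - {e}) (V - e). card f \<le> 3"
      using D by (intro card_trace_edges[OF H]) (auto simp: total_bound_def)
  next
    fix U assume U: "U \<subseteq> V - e" and dom: "dominates (trace (H - {e}) (V - e)) U (V - e)"
    show "2 * (n + 1 - int (card e)) \<le> int (card U) + 1"
    proof (rule loop_cases[OF H e])
      fix x assume x: "e = {x}"
      then have "dominates H U V"
        using dominates_contract_loop[OF H anti] e dom by blast
      then show ?thesis
        using D U x by (auto simp: total_bound_def)
    next
      \<comment> \<open>Adding \<open>e\<close> costs |e| vertices, and |e| \<le> 2 (|e| - 1) holds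
        from size 2 on.\<close>
      assume "2 \<le> card e"
      moreover have "2 * n \<le> int (card (U \<union> e)) + 1"
      proof -
        have "U \<union> e \<subseteq> V"
          using U edge_subset[OF H e] by blast
        then show ?thesis
          using D dominates_contract[OF H e dom] by (simp add: total_bound_def)
      qed
      moreover have "card (U \<union> e) \<le> card U + card e"
        by (rule card_Un_le)
      ultimately show ?thesis
        by arith
    qed
  qed
  then show "\<exists>e\<in>H. total_bound (V - e) (trace (H - {e}) (V - e)) (n + 1 - int (card e))"
    using e by blast
qed (rule total_bound_restrict)

section \<open>Edgewise domination, for (c)\<close>

definition edge_bound :: "'a set \<Rightarrow> 'a set set \<Rightarrow> int \<Rightarrow> bool" where
  "edge_bound V H n \<longleftrightarrow> (\<forall>F\<subseteq>H. dominates H (\<Union>F) V \<longrightarrow> n \<le> int (card F))"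

text \<open>Picking one edge for each trace keeps the count, and the union can only grow.\<close>

lemma trace_lift:
  assumes "F \<subseteq> trace H W"
  obtains G where "G \<subseteq> H" "card G = card F" "\<Union>F \<subseteq> \<Union>G"
proof -
  obtain G where "G \<subseteq> H" "inj_on (\<lambda>e. e \<inter> W) G" "F = (\<lambda>e. e \<inter> W) ` G"
    using assms unfolding trace_def subset_image_inj by blast
  then show ?thesis
    using that[of G] by (auto simp: card_image)
qed

interpretation edge: noncover_bound edge_bound
proof
  fix V :: "'a set" and H G n
  assume sub: "G \<subseteq> H" and D: "edge_bound V H n"
  show "edge_bound V G n"
    unfolding edge_bound_def
  proof (intro allI impI)
    fix F assume "F \<subseteq> G" "dominates G (\<Union>F) V"
    then have "F \<subseteq> H" "dominates H (\<Union>F) V"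
      using sub dominates_mono[of G _ V H] by auto
    then show "n \<le> int (card F)"
      using D by (simp add: edge_bound_def)
  qed
next
  fix V :: "'a set" and H n
  assume H: "no_isolated V H" and "V \<noteq> {}" and D: "edge_bound V H n"
  note fin = no_isolated_finite[OF H]
  have pos: "card V \<noteq> 0"
    using fin \<open>V \<noteq> {}\<close> by simp
  obtain f where f: "\<And>v. v \<in> V \<Longrightarrow> f v \<in> H \<and> v \<in> f v"
    using no_isolated_choice[OF H] by blast
  show "n < int (card V)"
  proof (cases "\<exists>e\<in>H. card e \<ge> 2")
    case True
    then obtain e where e: "e \<in> H" "card e \<ge> 2"
      by blast
    \<comment> \<open>The edge \<open>e\<close> takes care of at least two vertices at once, and one
      edge for each remaining vertex then gives a family of fewer than |V| edges covering
      \<open>V\<close>.\<close>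
    let ?F = "insert e (f ` (V - e))"
    have "?F \<subseteq> H" "V \<subseteq> \<Union>?F"
      using e f by auto
    then have "n \<le> int (card ?F)"
      using D dominates_self[OF H] unfolding edge_bound_def by blast
    moreover have "card ?F \<le> Suc (card (V - e))"
      using card_Un_le[of "{e}" "f ` (V - e)"] card_image_le[of "V - e" f] fin by simp
    moreover have "card (V - e) = card V - card e" "card e \<le> card V"
      using edge_subset[OF H e(1)] finite_edge[OF H e(1)] fin by (simp_all add: card_Diff_subset card_mono)
    ultimately show ?thesis
      using e by linarith
  next
    case False
    have "f v = {v}" if "v \<in> V" for v
      using loop_cases[OF H, of "f v"] f[OF that] False by (metis singletonD)
    then have "dominates H (\<Union>{}) V"
      using f by (force simp: dominates_iff)
    then have "n \<le> 0"
      using D unfolding edge_bound_def by (metis card.empty empty_subsetI of_nat_0)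
    then show ?thesis
      using pos by simp
  qed
next
  fix V :: "'a set" and H n
  assume H: "no_isolated V H" and V: "V \<noteq> {}" and anti: "antichain H" and D: "edge_bound V H n"
  obtain e where e: "e \<in> H"
    by (rule no_isolated_nonempty[OF H V])
  have "edge_bound (V - e) (trace (H - {e}) (V - e)) (n + 1 - int (card e))"
    unfolding edge_bound_def
  proof (intro allI impI)
    fix F assume F: "F \<subseteq> trace (H - {e}) (V - e)"
      and dom: "dominates (trace (H - {e}) (V - e)) (\<Union>F) (V - e)"
    obtain G where G: "G \<subseteq> H - {e}" "card G = card F" "\<Union>F \<subseteq> \<Union>G"
      using trace_lift[OF F] .
    show "n + 1 - int (card e) \<le> int (card F)"
    proof (rule loop_cases[OF H e])
      fix x assume x: "e = {x}"
      then have "dominates H (\<Union>F) V"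
        using dominates_contract_loop[OF H anti] e dom by blast
      then have "dominates H (\<Union>G) V"
        using G(3) dominates_mono by blast
      then have "n \<le> int (card G)"
        using D G(1) by (auto simp: edge_bound_def)
      then show ?thesis
        using G(2) x by simp
    next
      assume "2 \<le> card e"
      \<comment> \<open>The edge \<open>e\<close> counts only once, however large it is, and 1 \<le>
        |e| - 1.\<close>
      moreover have "dominates H (\<Union>(insert e G)) V"
        by (rule dominates_mono[OF dominates_contract[OF H e dom]]) (use G(3) in auto)
      then have "n \<le> int (card (insert e G))"
        using D G(1) e unfolding edge_bound_def by blast
      moreover have "card (insert e G) \<le> Suc (card G)"
        using card_Un_le[of "{e}" G] by simp
      ultimately show ?thesis
        using G(2) by linarith
    qed
  qed
  then show "\<exists>e\<in>H. edge_bound (V - e) (trace (H - {e}) (V - e)) (n + 1 - int (card e))"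
    using e by blast
next
  fix V :: "'a set" and W H n
  assume H: "no_isolated V H" and W: "W \<subseteq> V" and D: "edge_bound V H n"
  obtain f where f: "\<And>v. v \<in> V \<Longrightarrow> f v \<in> H \<and> v \<in> f v"
    using no_isolated_choice[OF H] by blast
  show "edge_bound W (trace H W) (n - int (card (V - W)))"
    unfolding edge_bound_def
  proof (intro allI impI)
    fix F assume F: "F \<subseteq> trace H W" and dom: "dominates (trace H W) (\<Union>F) W"
    obtain G where G: "G \<subseteq> H" "card G = card F" "\<Union>F \<subseteq> \<Union>G"
      using trace_lift[OF F] .
    \<comment> \<open>One edge through each removed vertex \<open>z\<close> does two jobs: it puts
      \<open>z\<close> into the union, for the edges reaching out of \<open>W\<close>, and it
      dominates \<open>z\<close>.\<close>
    let ?G = "G \<union> f ` (V - W)"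
    have sub: "\<Union>F \<union> (V - W) \<subseteq> \<Union>?G"
      using G(3) f by blast
    have "dominates H (\<Union>?G) V"
      unfolding dominates_iff
    proof
      fix v assume "v \<in> V"
      show "\<exists>e\<in>H. v \<in> e \<and> e - {v} \<subseteq> \<Union>?G"
      proof (cases "v \<in> W")
        case True
        then obtain e where e: "e \<in> H" "v \<in> e" "e \<inter> W - {v} \<subseteq> \<Union>F"
          using dom by (auto simp: dominates_trace_iff)
        then have "e - {v} \<subseteq> \<Union>F \<union> (V - W)"
          using edge_subset[OF H e(1)] by blast
        then show ?thesis
          using e sub by (meson subset_trans)
      next
        case False
        then show ?thesis
          using f[OF \<open>v \<in> V\<close>] \<open>v \<in> V\<close> by blast
      qed
    qed
    moreover have "?G \<subseteq> H"
      using G(1) f by auto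
    ultimately have "n \<le> int (card ?G)"
      using D unfolding edge_bound_def by blast
    moreover have "card ?G \<le> card G + card (f ` (V - W))"
      by (rule card_Un_le)
    moreover have "card (f ` (V - W)) \<le> card (V - W)"
      using no_isolated_finite[OF H] by (simp add: card_image_le)
    ultimately show "n - int (card (V - W)) \<le> int (card F)"
      using G(2) by linarith
  qed
qed

section \<open>Domination of strongly independent sets, for (b)\<close>

text \<open>A lower bound for a maximum is witnessed by one set \<open>A\<close>, which contraction
  and restriction can then shrink.\<close>

definition independent_bound :: "'a set \<Rightarrow> 'a set set \<Rightarrow> int \<Rightarrow> bool" where
  "independent_bound V H n \<longleftrightarrow> (\<forall>e\<in>H. card e \<le> 2) \<and>
     (\<exists>A. strongly_independent V H A \<and> (\<forall>U\<subseteq>V. dominates H U A \<longrightarrow> n \<le> int (card U)))"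

lemma strongly_independent_eq:
  assumes "strongly_independent V H A" "e \<in> H" "finite e" "v \<in> e \<inter> A" "w \<in> e \<inter> A"
  shows "v = w"
proof -
  have "card (e \<inter> A) \<le> Suc 0"
    using assms by (simp add: strongly_independent_def)
  then show ?thesis
    using assms by (metis card_le_Suc0_iff_eq finite_Int)
qed

text \<open>An edge is never contained in \<open>A\<close>, so this one is not a loop at
  \<open>a\<close>, and the size bound leaves room for just one vertex outside
  \<open>A\<close>.\<close>

lemma edge_at_independent:
  assumes H: "no_isolated V H" and A: "strongly_independent V H A"
    and e: "e \<in> H" "card e \<le> 2" "a \<in> e" "a \<in> A"
  obtains b where "e = {a, b}" "b \<notin> A"
proof -
  have "\<not> e \<subseteq> A"
    using A e(1) by (simp add: strongly_independent_def)
  then obtain b where b: "b \<in> e" "b \<notin> A"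
    by blast
  then have "card {a, b} = 2"
    using e by (metis card_2_iff)
  then have "e = {a, b}"
    using e b finite_edge[OF H e(1)] by (intro card_seteq[symmetric]) auto
  with b that show ?thesis
    by blast
qed

text \<open>For \<open>a\<close> in \<open>A\<close> and an edge \<open>e = {a, b}\<close>, adding
  \<open>b\<close> alone repairs domination: it dominates \<open>a\<close> and all its neighbours in
  \<open>A\<close>. The price of one vertex is |e| - 1. If \<open>A\<close> is empty, then
  \<open>n \<le> 0\<close> and any edge will do.\<close>

lemma independent_bound_contract:
  assumes H: "no_isolated V H" and "V \<noteq> {}" and anti: "antichain H" and D: "independent_bound V H n"
  shows "\<exists>e\<in>H. independent_bound (V - e) (trace (H - {e}) (V - e)) (n + 1 - int (card e))"
proof -
  obtain A where A: "strongly_independent V H A"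
    and "\<forall>U\<subseteq>V. dominates H U A \<longrightarrow> n \<le> int (card U)" and "\<forall>e\<in>H. card e \<le> 2"
    using D unfolding independent_bound_def by blast
  then have n: "n \<le> int (card U)" if "U \<subseteq> V" "dominates H U A" for U
    using that by simp
  have card2: "card e \<le> 2" if "e \<in> H" for e
    using D that by (simp add: independent_bound_def)
  have AV: "A \<subseteq> V"
    using A by (simp add: strongly_independent_def)
  have sizes: "\<forall>f\<in>trace (H - {e}) (V - e). card f \<le> 2" for e
    using card2 by (intro card_trace_edges[OF H]) auto
  show ?thesis
  proof (cases "A = {}")
    case True
    then have "n \<le> 0"
      using n[of "{}"] by (simp add: dominates_iff)
    obtain e where e: "e \<in> H"
      using no_isolated_nonempty[OF H \<open>V \<noteq> {}\<close>] .
    have "card e \<noteq> 0"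
      using edge_nonempty[OF H e] finite_edge[OF H e] by simp
    have "strongly_independent (V - e) (trace (H - {e}) (V - e)) {}"
      using no_isolated_contract[OF H anti e]
      by (simp add: strongly_independent_def no_isolated_def hypergraph_def)
    moreover have "n + 1 - int (card e) \<le> 0"
      using \<open>n \<le> 0\<close> \<open>card e \<noteq> 0\<close> by linarith
    ultimately have "independent_bound (V - e) (trace (H - {e}) (V - e)) (n + 1 - int (card e))"
      unfolding independent_bound_def using sizes by (intro conjI exI[of _ "{}"]) auto
    then show ?thesis
      using e by blast
  next
    case False
    then obtain a e where a: "a \<in> A" and e: "e \<in> H" "a \<in> e"
      using AV no_isolated_edge[OF H] by blast
    obtain b where b: "e = {a, b}" "b \<notin> A"
      using edge_at_independent[OF H A e(1) card2[OF e(1)] e(2) a] .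
    have card_e: "card e = 2"
      using a b by (metis card_2_iff)
    let ?H = "trace (H - {e}) (V - e)"
    \<comment> \<open>For a neighbour \<open>w\<close> of \<open>b\<close>, the edge
      \<open>{b, w}\<close> would have the loop \<open>{w}\<close> as its trace, so \<open>w\<close>
      could not stay in a strongly independent set.\<close>
    define B where "B = {w \<in> A - {a}. {b, w} \<notin> H}"
    have "independent_bound (V - e) ?H (n + 1 - int (card e))"
      unfolding independent_bound_def
    proof (intro conjI exI[of _ B] allI impI sizes)
      show "strongly_independent (V - e) ?H B"
        unfolding strongly_independent_def
      proof (intro conjI ballI)
        show "B \<subseteq> V - e"
          using AV b by (auto simp: B_def)
      next
        fix f' assume "f' \<in> ?H"
        then obtain f where f: "f \<in> H" "f \<noteq> e" "f' = f \<inter> (V - e)"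
          by (auto simp: trace_def)
        have "card (f \<inter> A) \<le> 1"
          using A f by (simp add: strongly_independent_def)
        moreover have "card (f' \<inter> B) \<le> card (f \<inter> A)"
          using finite_edge[OF H f(1)] f by (intro card_mono) (auto simp: B_def)
        ultimately show "card (f' \<inter> B) \<le> 1"
          by linarith
        show "\<not> f' \<subseteq> B"
        proof
          assume "f' \<subseteq> B"
          have "f' \<noteq> {}"
            using no_isolated_contract[OF H anti e(1)] \<open>f' \<in> ?H\<close>
            by (auto simp: no_isolated_def hypergraph_def)
          then obtain w where w: "w \<in> f'" "w \<in> B"
            using \<open>f' \<subseteq> B\<close> by blast
          then have "w \<in> f" "w \<in> A"
            using f by (auto simp: B_def)
          then obtain x where x: "f = {w, x}" "x \<notin> A"
            using edge_at_independent[OF H A f(1) card2[OF f(1)]] by blast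
          then have "x \<notin> f'"
            using \<open>f' \<subseteq> B\<close> by (auto simp: B_def)
          then have "x \<in> e"
            using x f edge_subset[OF H f(1)] by blast
          then have "f = {b, w}"
            using x a b by auto
          then show False
            using w f by (simp add: B_def)
        qed
      qed
    next
      fix U assume U: "U \<subseteq> V - e" and dom: "dominates ?H U B"
      have "dominates H (insert b U) A"
        unfolding dominates_iff
      proof
        fix v assume v: "v \<in> A"
        consider "v = a" | "{b, v} \<in> H" | "v \<in> B"
          using v by (auto simp: B_def)
        then show "\<exists>f\<in>H. v \<in> f \<and> f - {v} \<subseteq> insert b U"
        proof cases
          case 1
          then show ?thesis
            using e b by (intro bexI[of _ e]) auto
        next
          case 2
          then show ?thesis
            by (intro bexI[of _ "{b, v}"]) auto
        next
          case 3
          moreover have "B \<subseteq> V - e"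
            using AV b by (auto simp: B_def)
          ultimately obtain f where "f \<in> H - {e}"
            and f': "v \<in> f" "f \<inter> (V - e) - {v} \<subseteq> U"
            using dom unfolding dominates_trace_iff[OF \<open>B \<subseteq> V - e\<close>] by blast
          then have f: "f \<in> H" "v \<in> f" "f \<inter> (V - e) - {v} \<subseteq> U"
            by auto
          \<comment> \<open>An edge contains at most one vertex of \<open>A\<close>, so the trace
            can have lost only \<open>b\<close>.\<close>
          have "a \<notin> f"
            using strongly_independent_eq[OF A f(1) finite_edge[OF H f(1)], of a v] a f 3
            by (auto simp: B_def)
          then have "f - {v} \<subseteq> insert b U"
            using f b edge_subset[OF H f(1)] by blast
          then show ?thesis
            using f by blast
        qed
      qed
      moreover have "insert b U \<subseteq> V"
        using U b edge_subset[OF H e(1)] by auto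
      ultimately have "n \<le> int (card (insert b U))"
        by (rule n[rotated])
      moreover have "card (insert b U) \<le> Suc (card U)"
        using card_Un_le[of "{b}" U] by simp
      ultimately show "n + 1 - int (card e) \<le> int (card U)"
        using card_e by linarith
    qed
    then show ?thesis
      using e by blast
  qed
qed

lemma independent_bound_restrict:
  assumes H: "no_isolated V H" and W: "W \<subseteq> V" "\<And>e. e \<in> H \<Longrightarrow> e \<inter> W \<noteq> {}"
    and D: "independent_bound V H n"
  shows "independent_bound W (trace H W) (n - int (card (V - W)))"
proof -
  obtain A where A: "strongly_independent V H A"
    and "\<forall>U\<subseteq>V. dominates H U A \<longrightarrow> n \<le> int (card U)" and "\<forall>e\<in>H. card e \<le> 2"
    using D unfolding independent_bound_def by blast
  then have n: "n \<le> int (card U)" if "U \<subseteq> V" "dominates H U A" for U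
    using that by simp
  have card2: "card e \<le> 2" if "e \<in> H" for e
    using D that by (simp add: independent_bound_def)
  have AV: "A \<subseteq> V"
    using A by (simp add: strongly_independent_def)
  \<comment> \<open>If an edge at \<open>w\<close> leaves \<open>W\<close>, its trace is the loop
    \<open>{w}\<close>, so \<open>w\<close> must be dropped. It is then dominated by the other end
    of that edge, a removed vertex outside \<open>A\<close>.\<close>
  define B where "B = {w \<in> A \<inter> W. \<forall>e\<in>H. w \<in> e \<longrightarrow> e \<subseteq> W}"
  show ?thesis
    unfolding independent_bound_def
  proof (intro conjI exI[of _ B] allI impI)
    show "\<forall>e\<in>trace H W. card e \<le> 2"
      using card2 by (intro card_trace_edges[OF H]) auto
    show "strongly_independent W (trace H W) B"
      unfolding strongly_independent_def
    proof (intro conjI ballI)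
      show "B \<subseteq> W"
        by (auto simp: B_def)
    next
      fix e' assume "e' \<in> trace H W"
      then obtain e where e: "e \<in> H" "e' = e \<inter> W"
        by (auto simp: trace_def)
      have "card (e \<inter> A) \<le> 1"
        using A e by (simp add: strongly_independent_def)
      moreover have "card (e' \<inter> B) \<le> card (e \<inter> A)"
        using finite_edge[OF H e(1)] e by (intro card_mono) (auto simp: B_def)
      ultimately show "card (e' \<inter> B) \<le> 1"
        by linarith
      show "\<not> e' \<subseteq> B"
      proof
        assume "e' \<subseteq> B"
        then have "e \<subseteq> W"
          using W(2)[OF e(1)] e by (auto simp: B_def)
        then have "e \<subseteq> A"
          using \<open>e' \<subseteq> B\<close> e by (auto simp: B_def)
        then show False
          using A e by (simp add: strongly_independent_def)
      qed
    qed
  next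
    fix U assume U: "U \<subseteq> W" and dom: "dominates (trace H W) U B"
    let ?Z = "V - W"
    have fin: "finite ?Z"
      using no_isolated_finite[OF H] by simp
    obtain f where f: "\<And>v. v \<in> V \<Longrightarrow> f v \<in> H \<and> v \<in> f v"
      using no_isolated_choice[OF H] by blast
    \<comment> \<open>Each removed vertex costs one: itself if it lies outside \<open>A\<close>, a neighbour otherwise.\<close>
    define U' where "U' = U \<union> (?Z - A) \<union> (\<Union>z\<in>?Z \<inter> A. f z - {z})"
    have U'_sup: "U \<subseteq> U'" "?Z - A \<subseteq> U'"
      unfolding U'_def by blast+
    have f_sub: "f z - {z} \<subseteq> U'" if "z \<in> ?Z \<inter> A" for z
      using that unfolding U'_def by blast
    have "dominates H U' A"
      unfolding dominates_iff
    proof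
      fix v assume v: "v \<in> A"
      consider "v \<notin> W" | "v \<in> B" | e where "v \<in> W" "e \<in> H" "v \<in> e" "\<not> e \<subseteq> W"
        using v by (auto simp: B_def)
      then show "\<exists>e\<in>H. v \<in> e \<and> e - {v} \<subseteq> U'"
      proof cases
        case 1
        then show ?thesis
          using v AV f[of v] f_sub[of v] by (intro bexI[of _ "f v"]) auto
      next
        case 2
        moreover have "B \<subseteq> W"
          by (auto simp: B_def)
        ultimately obtain e where e: "e \<in> H" "v \<in> e" "e \<inter> W - {v} \<subseteq> U"
          using dom by (auto simp: dominates_trace_iff)
        moreover have "e \<subseteq> W"
          using 2 e by (simp add: B_def)
        ultimately have "e - {v} \<subseteq> U'"
          using U'_sup(1) by blast
        then show ?thesis
          using e by blast
      next
        case (3 e)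
        then obtain x where x: "e = {v, x}" "x \<notin> A"
          using edge_at_independent[OF H A _ card2 _ v] by metis
        then have "x \<in> U'"
          using 3 edge_subset[OF H 3(2)] U'_sup(2) by auto
        then show ?thesis
          using 3 x by (intro bexI[of _ e]) auto
      qed
    qed
    moreover have "f z - {z} \<subseteq> V" if "z \<in> V" for z
      using edge_subset[OF H] f[OF that] by blast
    then have "U' \<subseteq> V"
      using U W unfolding U'_def by blast
    ultimately have "n \<le> int (card U')"
      by (rule n[rotated])
    moreover have "card U' \<le> card U + card (?Z - A) + card (\<Union>z\<in>?Z \<inter> A. f z - {z})"
      unfolding U'_def by (meson add_le_mono1 card_Un_le order_trans)
    moreover have "card (\<Union>z\<in>?Z \<inter> A. f z - {z}) \<le> 1 * card (?Z \<inter> A)"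
    proof (rule card_UN_bound)
      fix z assume "z \<in> ?Z \<inter> A"
      then have "f z \<in> H" "z \<in> f z"
        using f by auto
      then show "card (f z - {z}) \<le> 1"
        using card2[of "f z"] by (simp add: card_Diff_singleton_if)
    qed (use fin in simp)
    moreover have "card ?Z = card (?Z - A) + card (?Z \<inter> A)"
      using fin card_Diff_subset_Int[of ?Z A] card_mono[of ?Z "?Z \<inter> A"] by simp
    ultimately show "n - int (card ?Z) \<le> int (card U)"
      by linarith
  qed
qed

interpretation independent: noncover_bound independent_bound
proof
  fix V :: "'a set" and H G n
  assume "G \<subseteq> H" and D: "independent_bound V H n"
  obtain A where A: "strongly_independent V H A"
    and "\<forall>U\<subseteq>V. dominates H U A \<longrightarrow> n \<le> int (card U)" and "\<forall>e\<in>H. card e \<le> 2"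
    using D unfolding independent_bound_def by blast
  then have n: "n \<le> int (card U)" if "U \<subseteq> V" "dominates H U A" for U
    using that by simp
  have card2: "card e \<le> 2" if "e \<in> H" for e
    using D that by (simp add: independent_bound_def)
  have "strongly_independent V G A"
    using A \<open>G \<subseteq> H\<close> by (auto simp: strongly_independent_def)
  moreover have "n \<le> int (card U)" if "U \<subseteq> V" "dominates G U A" for U
    using n[OF that(1)] dominates_mono[OF that(2) \<open>G \<subseteq> H\<close> order_refl] by simp
  moreover have "card e \<le> 2" if "e \<in> G" for e
    using card2 \<open>G \<subseteq> H\<close> that by blast
  ultimately show "independent_bound V G n"
    unfolding independent_bound_def by blast
next
  fix V :: "'a set" and H n
  assume H: "no_isolated V H" and "V \<noteq> {}" and D: "independent_bound V H n"
  note fin = no_isolated_finite[OF H]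
  obtain A where A: "strongly_independent V H A"
    and "\<forall>U\<subseteq>V. dominates H U A \<longrightarrow> n \<le> int (card U)" and "\<forall>e\<in>H. card e \<le> 2"
    using D unfolding independent_bound_def by blast
  then have n: "n \<le> int (card U)" if "U \<subseteq> V" "dominates H U A" for U
    using that by simp
  have card2: "card e \<le> 2" if "e \<in> H" for e
    using D that by (simp add: independent_bound_def)
  have AV: "A \<subseteq> V"
    using A by (simp add: strongly_independent_def)
  obtain f where f: "\<And>v. v \<in> V \<Longrightarrow> f v \<in> H \<and> v \<in> f v"
    using no_isolated_choice[OF H] by blast
  \<comment> \<open>One neighbour for each vertex of \<open>A\<close> gives
    \<open>n \<le> int (card A)\<close>; strictness comes from \<open>A \<noteq> V\<close>, since
    \<open>A\<close> contains no edge.\<close>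
  have "dominates H (\<Union>a\<in>A. f a - {a}) A"
    unfolding dominates_iff using f AV by blast
  moreover have "f a - {a} \<subseteq> V" if "a \<in> A" for a
    using edge_subset[OF H] f AV that by blast
  then have "(\<Union>a\<in>A. f a - {a}) \<subseteq> V"
    by blast
  ultimately have "n \<le> int (card (\<Union>a\<in>A. f a - {a}))"
    by (rule n[rotated])
  moreover have "card (\<Union>a\<in>A. f a - {a}) \<le> 1 * card A"
  proof (rule card_UN_bound)
    fix a assume "a \<in> A"
    then have "f a \<in> H" "a \<in> f a"
      using f AV by auto
    then show "card (f a - {a}) \<le> 1"
      using card2[of "f a"] by (simp add: card_Diff_singleton_if)
  qed (use AV fin finite_subset in blast)
  moreover have "A \<noteq> V"
  proof
    assume "A = V"
    obtain v where "v \<in> V"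
      using \<open>V \<noteq> {}\<close> by blast
    then have "f v \<in> H" "f v \<subseteq> A"
      using f edge_subset[OF H] \<open>A = V\<close> by auto
    then show False
      using A by (simp add: strongly_independent_def)
  qed
  then have "card A < card V"
    using AV fin by (simp add: psubset_card_mono psubset_eq)
  ultimately show "n < int (card V)"
    by linarith
qed (fact independent_bound_contract, fact independent_bound_restrict)

section \<open>The domination parameters satisfy their bounds\<close>

lemma total_bound_strong_total_domination_number:
  assumes "no_isolated V H" "\<forall>e\<in>H. card e \<le> 3"
  shows "total_bound V H \<lceil>real (strong_total_domination_number V H) / 2\<rceil>"
  unfolding total_bound_def
proof (intro conjI allI impI)
  fix U assume "U \<subseteq> V" "dominates H U V"
  then have "strong_total_domination_number V H \<le> card U"
    unfolding strong_total_domination_number_def domination_number_of_def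
    using no_isolated_finite[OF assms(1)] by (intro Min_le) auto
  then show "2 * \<lceil>real (strong_total_domination_number V H) / 2\<rceil> \<le> int (card U) + 1"
    by linarith
qed (use assms in blast)

lemma edge_bound_edgewise_domination_number:
  assumes "no_isolated V H"
  shows "edge_bound V H (int (edgewise_domination_number V H))"
  unfolding edge_bound_def
proof (intro allI impI)
  fix F assume "F \<subseteq> H" "dominates H (\<Union>F) V"
  then have "edgewise_domination_number V H \<le> card F"
    unfolding edgewise_domination_number_def
    using no_isolated_finite[OF assms(1)] by (intro Min_le) auto
  then show "int (edgewise_domination_number V H) \<le> int (card F)"
    by simp
qed

lemma independent_bound_strong_independence_domination_number:
  assumes H: "no_isolated V H" and "\<forall>e\<in>H. card e \<le> 2"
  shows "independent_bound V H (int (strong_independence_domination_number V H))"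
proof -
  let ?S = "{domination_number_of V H A | A. strongly_independent V H A}"
  note fin = no_isolated_finite[OF H]
  have "?S \<subseteq> domination_number_of V H ` Pow V"
    by (auto simp: strongly_independent_def)
  then have "finite ?S"
    using fin finite_subset by blast
  moreover have "strongly_independent V H {}"
    using edge_nonempty[OF H] by (auto simp: strongly_independent_def)
  then have "?S \<noteq> {}"
    by blast
  ultimately have "strong_independence_domination_number V H \<in> ?S"
    unfolding strong_independence_domination_number_def by (rule Max_in)
  then obtain A where A: "strongly_independent V H A"
    "strong_independence_domination_number V H = domination_number_of V H A"
    by blast
  have "strong_independence_domination_number V H \<le> card U" if "U \<subseteq> V" "dominates H U A" for U
    unfolding A(2) domination_number_of_def using fin that by (intro Min_le) auto
  then show ?thesis
    unfolding independent_bound_def using assms A(1) by auto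
qed

theorem theorem1p6:
  fixes V :: "'a set" and H :: "'a set set"
  assumes "hypergraph V H"
    and "\<forall>v\<in>V. \<not> isolated H v"
  shows "((\<forall>e\<in>H. card e \<le> 3) \<longrightarrow>
            Leray_number V (noncover_complex V H)
              \<le> ereal (real_of_int (int (card V)
                  - \<lceil>real (strong_total_domination_number V H) / 2\<rceil> - 1)))
       \<and> ((\<forall>e\<in>H. card e \<le> 2) \<longrightarrow>
            Leray_number V (noncover_complex V H)
              \<le> ereal (real_of_int (int (card V)
                  - int (strong_independence_domination_number V H) - 1)))
       \<and> Leray_number V (noncover_complex V H)
              \<le> ereal (real_of_int (int (card V)
                  - int (edgewise_domination_number V H) - 1))"
proof -
  have H: "no_isolated V H"
    using assms by (simp add: no_isolated_def)
  show ?thesis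
    using total.Leray_number_noncover_le[OF H total_bound_strong_total_domination_number[OF H]]
      independent.Leray_number_noncover_le[OF H
        independent_bound_strong_independence_domination_number[OF H]]
      edge.Leray_number_noncover_le[OF H edge_bound_edgewise_domination_number[OF H]]
    by blast
qed

end
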